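(* Let $\mathbf{k}$ be a commutative ring, $q\in\mathbf{k}$, $\pi\in S_n$ and $\alpha$ a composition with $n$ entries. Then \[U^q_{\pi,\alpha}=\sum_{\substack{I\subseteq\operatorname{Des}(\pi)\\ J\subseteq\operatorname{Peak}(\pi)\\ I\cap J=\emptyset}}(-q)^{|J|}(q-1)^{|I|}\,\eta^{(q)}_{\alpha^{\downarrow I\downarrow\downarrow J}}.\]
   Context: Let $x_1,x_2,\dots$ be commuting indeterminates, working in $\mathbf{k}[[x_1,x_2,\dots]]$. Let $\mathbb{P}=\{1,2,\dots\}$ and $\mathbb{P}^{\pm}=\mathbb{P}\cup(-\mathbb{P})$ totally ordered by $-1<1<-2<2<\cdots$. For a partial order $<_P$ on $[n]$, an enriched $P$-partition is a map $f:[n]\to\mathbb{P}^{\pm}$ such that (i) if $i<_P j$ and $i<j$ then $f(i)<f(j)$ or $f(i)=f(j)\in\mathbb{P}$; (ii) if $i<_P j$ and $i>j$ then $f(i)<f(j)$ or $f(i)=f(j)\in-\mathbb{P}$. For $\pi=\pi_1\cdots\pi_n\in S_n$ and a composition (sequence of positive integers) $\alpha=(\alpha_1,\dots,\alpha_n)$, let $<_\pi$ be the total order $\pi_1<_\pi\cdots<_\pi\pi_n$ and $\epsilon(\pi_i)=\alpha_i$; set $U^q_{\pi,\alpha}=\sum_f\prod_{i=1}^n q^{[f(i)<0]}x_{|f(i)|}^{\epsilon(i)}$ over enriched $P$-partitions $f$ for $<_\pi$, where $[f(i)<0]\in\{0,1\}$ indicates negativity. For a composition $\beta$ with $k$ entries,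 $\eta^{(q)}_\beta=U^q_{id_k,\beta}$ with $id_k=12\cdots k$; equivalently $\eta^{(q)}_\beta=\sum_{i_1\le\cdots\le i_k}(q+1)^{|\{i_1,\dots,i_k\}|}x_{i_1}^{\beta_1}\cdots x_{i_k}^{\beta_k}$. $\operatorname{Des}(\pi)=\{1\le i\le n-1:\pi(i)>\pi(i+1)\}$, $\operatorname{Peak}(\pi)=\{2\le i\le n-1:\pi(i-1)<\pi(i)>\pi(i+1)\}$. A subset of $[n-1]$ is peak-lacunar if it contains neither $1$ nor two consecutive integers. For $1\le i\le n-1$, $\alpha^{\downarrow i}=(\alpha_1,\dots,\alpha_{i-1},\alpha_i+\alpha_{i+1},\alpha_{i+2},\dots,\alpha_n)$; for $I=\{i_1<\cdots<i_k\}\subseteq[n-1]$, $\alpha^{\downarrow I}=((\cdots(\alpha^{\downarrow i_k})\cdots)^{\downarrow i_2})^{\downarrow i_1}$. For $I,J\subseteq[n-1]$ with $J$ peak-lacunar, $\alpha^{\downarrow I\downarrow\downarrow J}=\alpha^{\downarrow K}$ with $K=I\cup J\cup(J-1)$, where $J-1=\{j-1:j\in J\}$. *)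

theory Defs
  imports
    "HOL-Library.Poly_Mapping"
    "HOL-Library.FuncSet"
    "HOL-Combinatorics.Permutations"
begin

section \<open>Formal power series in countably many commuting indeterminates\<close>

text \<open>A power series is its family of coefficients, indexed by exponent vectors of finite support.
  Indeterminates are indexed by all of \<^typ>\<open>nat\<close>; the series below only involve
  indices that are at least 1. Only the module structure is set up, since the only products that
  occur are monomials.\<close>

typedef 'k mfps = "UNIV :: ((nat \<Rightarrow>\<^sub>0 nat) \<Rightarrow> 'k) set"
  morphisms mfps_coeff Abs_mfps ..

setup_lifting type_definition_mfps

lemma mfps_eqI: "(\<And>m. mfps_coeff F m = mfps_coeff G m) \<Longrightarrow> F = G"
  by (simp add: mfps_coeff_inject[symmetric] fun_eq_iff)

instantiation mfps :: (ab_group_add) ab_group_add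
begin

lift_definition zero_mfps :: "'a mfps" is "\<lambda>m. 0" .
lift_definition plus_mfps :: "'a mfps \<Rightarrow> 'a mfps \<Rightarrow> 'a mfps" is "\<lambda>F G m. F m + G m" .
lift_definition minus_mfps :: "'a mfps \<Rightarrow> 'a mfps \<Rightarrow> 'a mfps" is "\<lambda>F G m. F m - G m" .
lift_definition uminus_mfps :: "'a mfps \<Rightarrow> 'a mfps" is "\<lambda>F m. - F m" .

instance
  by standard (transfer; simp add: fun_eq_iff algebra_simps)+

end

lift_definition mfps_smult :: "'k::comm_ring_1 \<Rightarrow> 'k mfps \<Rightarrow> 'k mfps"
  is "\<lambda>c F m. c * F m" .

text \<open>The monomial with exponent vector \<open>e\<close>, that is, the product of the
  \<open>x\<^sub>j\<close> raised to the power \<open>Poly_Mapping.lookup e j\<close>.\<close>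

definition mfps_monom :: "(nat \<Rightarrow>\<^sub>0 nat) \<Rightarrow> 'k::comm_ring_1 mfps" where
  "mfps_monom e = Abs_mfps (\<lambda>m. if m = e then 1 else 0)"

lemma mfps_coeff_monom: "mfps_coeff (mfps_monom e) m = (if m = e then 1 else 0)"
  by (simp add: mfps_monom_def Abs_mfps_inverse)

text \<open>The sum of a possibly infinite family is taken coefficientwise. It is meaningful for families
  in which every exponent vector has a nonzero coefficient in only finitely many members.\<close>

definition mfps_summable :: "'b set \<Rightarrow> ('b \<Rightarrow> 'k::comm_ring_1 mfps) \<Rightarrow> bool" where
  "mfps_summable A F \<longleftrightarrow> (\<forall>m. finite {a \<in> A. mfps_coeff (F a) m \<noteq> 0})"

lift_definition mfps_sum :: "'b set \<Rightarrow> ('b \<Rightarrow> 'k::comm_ring_1 mfps) \<Rightarrow> 'k mfps"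
  is "\<lambda>A F m. \<Sum>a | a \<in> A \<and> F a m \<noteq> 0. F a m" .


section \<open>Enriched P-partitions\<close>

text \<open>Signed positive integers are the nonzero elements of \<^typ>\<open>int\<close>, ordered by
  \<open>-1 < 1 < -2 < 2 < \<dots>\<close>.\<close>

definition signed_less :: "int \<Rightarrow> int \<Rightarrow> bool" where
  "signed_less a b \<longleftrightarrow> \<bar>a\<bar> < \<bar>b\<bar> \<or> (\<bar>a\<bar> = \<bar>b\<bar> \<and> a < b)"

text \<open>Extensional functions are used so that each map on \<open>{1..n}\<close> is represented once.\<close>

definition enriched_partitions :: "nat \<Rightarrow> (nat \<Rightarrow> nat \<Rightarrow> bool) \<Rightarrow> (nat \<Rightarrow> int) set" where
  "enriched_partitions n lt =
    {f \<in> {1..n} \<rightarrow>\<^sub>E (UNIV - {0}).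
      \<forall>i\<in>{1..n}. \<forall>j\<in>{1..n}. lt i j \<longrightarrow>
        (i < j \<longrightarrow> signed_less (f i) (f j) \<or> (f i = f j \<and> f i > 0)) \<and>
        (i > j \<longrightarrow> signed_less (f i) (f j) \<or> (f i = f j \<and> f i < 0))}"

definition composition :: "nat list \<Rightarrow> bool" where
  "composition \<alpha> \<longleftrightarrow> (\<forall>a\<in>set \<alpha>. a > 0)"

definition perm_less :: "nat \<Rightarrow> (nat \<Rightarrow> nat) \<Rightarrow> nat \<Rightarrow> nat \<Rightarrow> bool" where
  "perm_less n \<pi> u v \<longleftrightarrow> (\<exists>i j. 1 \<le> i \<and> i < j \<and> j \<le> n \<and> u = \<pi> i \<and> v = \<pi> j)"

text \<open>The entry of index \<open>i\<close> (counted from 1) of a composition \<open>\<alpha>\<close> is \<open>\<alpha> ! (i - 1)\<close>; thus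
  \<open>perm_weight \<pi> \<alpha> (\<pi> i)\<close> is that entry.\<close>

definition perm_weight :: "(nat \<Rightarrow> nat) \<Rightarrow> nat list \<Rightarrow> nat \<Rightarrow> nat" where
  "perm_weight \<pi> \<alpha> u = \<alpha> ! (inv \<pi> u - 1)"

definition U_term :: "'k::comm_ring_1 \<Rightarrow> (nat \<Rightarrow> nat) \<Rightarrow> nat list \<Rightarrow> (nat \<Rightarrow> int) \<Rightarrow> 'k mfps" where
  "U_term q \<pi> \<alpha> f =
    mfps_smult (\<Prod>i\<in>{1..length \<alpha>}. q ^ (if f i < 0 then 1 else 0))
      (mfps_monom (\<Sum>i\<in>{1..length \<alpha>}. Poly_Mapping.single (nat \<bar>f i\<bar>) (perm_weight \<pi> \<alpha> i)))"

definition U :: "'k::comm_ring_1 \<Rightarrow> (nat \<Rightarrow> nat) \<Rightarrow> nat list \<Rightarrow> 'k mfps" where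
  "U q \<pi> \<alpha> = mfps_sum (enriched_partitions (length \<alpha>) (perm_less (length \<alpha>) \<pi>)) (U_term q \<pi> \<alpha>)"

definition eta :: "'k::comm_ring_1 \<Rightarrow> nat list \<Rightarrow> 'k mfps" where
  "eta q \<beta> = U q id \<beta>"

lemma lookup_sum_mfps: "Poly_Mapping.lookup (sum g A) k = (\<Sum>a\<in>A. Poly_Mapping.lookup (g a) k)"
  by (induction A rule: infinite_finite_induct) (auto simp: lookup_add)

lemma mfps_summable_U_term:
  assumes "\<pi> permutes {1..length \<alpha>}" "composition \<alpha>"
  shows "mfps_summable (enriched_partitions (length \<alpha>) lt) (U_term q \<pi> \<alpha>)"
  unfolding mfps_summable_def
proof
  fix m :: "nat \<Rightarrow>\<^sub>0 nat"
  let ?n = "length \<alpha>"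
  let ?S = "{f \<in> enriched_partitions ?n lt. mfps_coeff (U_term q \<pi> \<alpha> f) m \<noteq> 0}"
  let ?V = "int ` Poly_Mapping.keys m \<union> (\<lambda>k. - int k) ` Poly_Mapping.keys m"
  have "f \<in> {1..?n} \<rightarrow>\<^sub>E ?V" if f: "f \<in> ?S" for f
  proof (rule PiE_I)
    fix i assume i: "i \<in> {1..?n}"
    have m: "m = (\<Sum>i\<in>{1..?n}. Poly_Mapping.single (nat \<bar>f i\<bar>) (perm_weight \<pi> \<alpha> i))"
      using f by (auto simp: U_term_def mfps_smult.rep_eq mfps_coeff_monom split: if_splits)
    have "inv \<pi> i \<in> {1..?n}"
      using assms(1) i by (metis permutes_in_image permutes_inv)
    then have "perm_weight \<pi> \<alpha> i > 0"
      using assms(2) by (auto simp: perm_weight_def composition_def)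
    moreover have "Poly_Mapping.lookup m (nat \<bar>f i\<bar>) =
        (\<Sum>j\<in>{1..?n}. Poly_Mapping.lookup (Poly_Mapping.single (nat \<bar>f j\<bar>) (perm_weight \<pi> \<alpha> j)) (nat \<bar>f i\<bar>))"
      using lookup_sum_mfps[of "\<lambda>j. Poly_Mapping.single (nat \<bar>f j\<bar>) (perm_weight \<pi> \<alpha> j)"] m by simp
    moreover have "\<dots> \<ge> Poly_Mapping.lookup (Poly_Mapping.single (nat \<bar>f i\<bar>) (perm_weight \<pi> \<alpha> i)) (nat \<bar>f i\<bar>)"
      using i by (intro member_le_sum) auto
    ultimately have "Poly_Mapping.lookup m (nat \<bar>f i\<bar>) > 0"
      by (simp only: lookup_single_eq)
    then have "nat \<bar>f i\<bar> \<in> Poly_Mapping.keys m"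
      by (simp add: in_keys_iff)
    moreover have "f i = int (nat \<bar>f i\<bar>) \<or> f i = - int (nat \<bar>f i\<bar>)" by linarith
    ultimately show "f i \<in> ?V" by blast
  next
    fix i assume "i \<notin> {1..?n}"
    then show "f i = undefined"
      using f by (auto simp: enriched_partitions_def PiE_def extensional_def)
  qed
  then have "?S \<subseteq> {1..?n} \<rightarrow>\<^sub>E ?V" by blast
  then show "finite ?S"
    by (rule finite_subset) (intro finite_PiE, auto)
qed


section \<open>Descents, peaks and merging of entries\<close>

definition Des :: "nat \<Rightarrow> (nat \<Rightarrow> nat) \<Rightarrow> nat set" where
  "Des n \<pi> = {i. 1 \<le> i \<and> i \<le> n - 1 \<and> \<pi> i > \<pi> (i + 1)}"

definition Peak :: "nat \<Rightarrow> (nat \<Rightarrow> nat) \<Rightarrow> nat set" where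
  "Peak n \<pi> = {i. 2 \<le> i \<and> i \<le> n - 1 \<and> \<pi> (i - 1) < \<pi> i \<and> \<pi> i > \<pi> (i + 1)}"

definition merge_at :: "nat list \<Rightarrow> nat \<Rightarrow> nat list" where
  "merge_at \<alpha> i = take (i - 1) \<alpha> @ [\<alpha> ! (i - 1) + \<alpha> ! i] @ drop (i + 1) \<alpha>"

text \<open>With \<^const>\<open>foldr\<close> the largest position is merged first, so that the smaller
  positions still to be merged keep their meaning.\<close>

definition merge_set :: "nat list \<Rightarrow> nat set \<Rightarrow> nat list" where
  "merge_set \<alpha> I = foldr (\<lambda>i \<beta>. merge_at \<beta> i) (sorted_list_of_set I) \<alpha>"

text \<open>Intended for peak-lacunar \<open>J\<close>; every set of peaks is of this kind.\<close>

definition merge_set2 :: "nat list \<Rightarrow> nat set \<Rightarrow> nat set \<Rightarrow> nat list" where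
  "merge_set2 \<alpha> I J = merge_set \<alpha> (I \<union> J \<union> (\<lambda>j. j - 1) ` J)"

definition peak_lacunar :: "nat \<Rightarrow> nat set \<Rightarrow> bool" where
  "peak_lacunar n J \<longleftrightarrow> J \<subseteq> {1..n - 1} \<and> 1 \<notin> J \<and> (\<forall>j\<in>J. j + 1 \<notin> J)"

lemma peak_lacunar_subset_Peak:
  assumes "J \<subseteq> Peak n \<pi>"
  shows "peak_lacunar n J"
proof -
  have "j + 1 \<notin> J" if "j \<in> J" for j
  proof
    assume "j + 1 \<in> J"
    with that assms have "j \<in> Peak n \<pi>" "j + 1 \<in> Peak n \<pi>" by auto
    then show False by (simp add: Peak_def)
  qed
  moreover have "J \<subseteq> {1..n - 1}" "1 \<notin> J"
    using assms by (auto simp: Peak_def)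
  ultimately show ?thesis by (simp add: peak_lacunar_def)
qed

end

theory Submission imports Defs begin

text \<open>Both sides are compared coefficientwise, grouping the enriched partitions \<open>f\<close> by the weakly
  increasing sequence \<open>h i = \<bar>f (\<pi> i)\<bar>\<close>. Let \<open>E\<close> be the set of positions \<open>i\<close> with
  \<open>h i = h (i + 1)\<close>. A descent in \<open>E\<close> forces a minus sign at \<open>i\<close>, an ascent in \<open>E\<close> forces a plus sign
  at \<open>i + 1\<close>, and all remaining signs are free; so \<open>h\<close> contributes
  \<open>q ^ card (Des \<inter> E) * (1 + q) ^ (n - card E)\<close> to \<open>U\<close>, unless some peak \<open>j\<close> has \<open>j - 1, j \<in> E\<close>, in
  which case it contributes \<open>0\<close>. Merging the entries at \<open>K\<close> restricts \<open>\<eta>\<close> to those \<open>h\<close> with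
  \<open>K \<subseteq> E\<close>, so on the right-hand side \<open>h\<close> collects a sum over \<open>I\<close> and \<open>J\<close> that factors over the
  descents in \<open>E\<close>: the factor is \<open>1 + (q - 1) - q = 0\<close> for a peak \<open>j\<close> with \<open>j - 1 \<in> E\<close> and
  \<open>1 + (q - 1) = q\<close> otherwise.\<close>

section \<open>Sums over subsets of a finite set\<close>

lemma sum_Pow_binomial:
  fixes a b :: "'a::comm_ring_1"
  assumes "finite X"
  shows "(\<Sum>S\<in>Pow X. a ^ card S * b ^ card (X - S)) = (a + b) ^ card X"
  using prod_add[OF assms, of "\<lambda>_. a" "\<lambda>_. b"] by simp

text \<open>If \<open>A\<close> and \<open>B\<close> are disjoint, such an \<open>S\<close> is
  \<open>A\<close> together with an arbitrary subset of \<open>X - A - B\<close>, and the binomial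
  formula sums over that subset. In the application \<open>S\<close> is the set of negative
  positions, \<open>A\<close> holds the forced minus signs and \<open>B\<close> the forced plus
  signs.\<close>

lemma sum_between_sets:
  fixes q :: "'a::comm_ring_1"
  assumes "finite X" "A \<subseteq> X" "B \<subseteq> X"
  shows "(\<Sum>S | S \<subseteq> X \<and> A \<subseteq> S \<and> S \<inter> B = {}. q ^ card S) =
    (if A \<inter> B = {} then q ^ card A * (1 + q) ^ (card X - card A - card B) else 0)"
proof (cases "A \<inter> B = {}")
  case False
  then have none: "{S. S \<subseteq> X \<and> A \<subseteq> S \<and> S \<inter> B = {}} = {}" by blast
  show ?thesis unfolding none using False by simp
next
  case True
  let ?Y = "X - A - B"
  have fin: "finite A" "finite B" "finite ?Y" using assms finite_subset by auto
  have "(\<Sum>S | S \<subseteq> X \<and> A \<subseteq> S \<and> S \<inter> B = {}. q ^ card S) = (\<Sum>T\<in>Pow ?Y. q ^ card A * q ^ card T)"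
  proof (rule sum.reindex_bij_witness[where i = "\<lambda>T. A \<union> T" and j = "\<lambda>S. S - A"])
    fix S assume S: "S \<in> {S. S \<subseteq> X \<and> A \<subseteq> S \<and> S \<inter> B = {}}"
    then have "card S = card A + card (S - A)"
      using fin assms by (metis (no_types, lifting) Diff_disjoint Diff_partition card_Un_disjoint
          finite_Diff infinite_super mem_Collect_eq)
    then show "q ^ card A * q ^ card (S - A) = q ^ card S" by (simp add: power_add)
  qed (use assms True in auto)
  also have "\<dots> = q ^ card A * (q + 1) ^ card ?Y"
    using sum_Pow_binomial[OF fin(3), of q 1] by (simp add: sum_distrib_left[symmetric])
  also have "?Y = X - (A \<union> B)" by blast
  also have "card \<dots> = card X - card A - card B"
    using assms True fin by (simp add: card_Diff_subset card_Un_disjoint)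
  finally show ?thesis using True by (simp add: add.commute)
qed

text \<open>For fixed \<open>J\<close> the sum over \<open>I\<close> gives
  \<open>q ^ card (A - J)\<close>, because \<open>(q - 1) + 1 = q\<close>. Splitting
  \<open>A - J\<close> into \<open>A - P\<close> and \<open>P - J\<close> leaves the expansion of
  \<open>(- q + q) ^ card P\<close>, which vanishes unless \<open>P\<close> is empty.\<close>

lemma sum_disjoint_pairs:
  fixes q :: "'a::comm_ring_1"
  assumes "finite A" "P \<subseteq> A"
  shows "(\<Sum>(I, J) | I \<subseteq> A \<and> J \<subseteq> P \<and> I \<inter> J = {}. (- q) ^ card J * (q - 1) ^ card I) =
    (if P = {} then q ^ card A else 0)"
proof -
  have finP: "finite P" using assms finite_subset by auto
  have "(\<Sum>(I, J) | I \<subseteq> A \<and> J \<subseteq> P \<and> I \<inter> J = {}. (- q) ^ card J * (q - 1) ^ card I) =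
    (\<Sum>(J, I)\<in>(SIGMA J:Pow P. Pow (A - J)). (- q) ^ card J * (q - 1) ^ card I)"
    by (rule sum.reindex_bij_witness[where i = "\<lambda>(J, I). (I, J)" and j = "\<lambda>(I, J). (J, I)"]) auto
  also have "\<dots> = (\<Sum>J\<in>Pow P. \<Sum>I\<in>Pow (A - J). (- q) ^ card J * (q - 1) ^ card I)"
    using assms finP by (subst sum.Sigma) auto
  also have "\<dots> = (\<Sum>J\<in>Pow P. q ^ card (A - P) * ((- q) ^ card J * q ^ card (P - J)))"
  proof (rule sum.cong[OF refl])
    fix J assume J: "J \<in> Pow P"
    have "A - J = (A - P) \<union> (P - J)" using J assms by auto
    then have "card (A - J) = card (A - P) + card (P - J)"
      using assms finP by (metis Diff_disjoint Diff_Int_distrib2 card_Un_disjoint finite_Diff Int_Diff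
          Int_commute)
    then show "(\<Sum>I\<in>Pow (A - J). (- q) ^ card J * (q - 1) ^ card I) =
        q ^ card (A - P) * ((- q) ^ card J * q ^ card (P - J))"
      using sum_Pow_binomial[of "A - J" "q - 1" 1] assms
      by (simp add: sum_distrib_left[symmetric] power_add algebra_simps)
  qed
  also have "\<dots> = (if P = {} then q ^ card A else 0)"
    using sum_Pow_binomial[OF finP, of "- q" q] finP by (auto simp: sum_distrib_left[symmetric] card_gt_0_iff power_0_left)
  finally show ?thesis .
qed

section \<open>Weakly increasing index sequences\<close>

definition repeats :: "nat \<Rightarrow> (nat \<Rightarrow> nat) \<Rightarrow> nat set" where
  "repeats n h = {i \<in> {1..<n}. h i = h (i + 1)}"

definition exponent :: "nat list \<Rightarrow> (nat \<Rightarrow> nat) \<Rightarrow> nat \<Rightarrow>\<^sub>0 nat" where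
  "exponent \<alpha> h = (\<Sum>i\<in>{1..length \<alpha>}. Poly_Mapping.single (h i) (\<alpha> ! (i - 1)))"

text \<open>Bounding the values by the keys of \<open>m\<close> makes the set finite. For a
  composition \<open>\<alpha>\<close> this excludes no sequence of positive indices, by
  \<open>keys_exponent\<close>; zero is removed because the indeterminates are counted from
  1.\<close>

definition index_maps :: "nat list \<Rightarrow> (nat \<Rightarrow>\<^sub>0 nat) \<Rightarrow> (nat \<Rightarrow> nat) set" where
  "index_maps \<alpha> m = {h \<in> {1..length \<alpha>} \<rightarrow>\<^sub>E (Poly_Mapping.keys m - {0}).
     (\<forall>i\<in>{1..<length \<alpha>}. h i \<le> h (i + 1)) \<and> exponent \<alpha> h = m}"

lemma finite_repeats [simp]: "finite (repeats n h)"
  by (simp add: repeats_def)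

lemma finite_index_maps: "finite (index_maps \<alpha> m)"
  by (rule finite_subset[of _ "{1..length \<alpha>} \<rightarrow>\<^sub>E (Poly_Mapping.keys m - {0})"])
    (auto simp: index_maps_def intro!: finite_PiE)

text \<open>Exponents are natural numbers, so the positive contribution of position \<open>i\<close>
  cannot cancel.\<close>

lemma keys_exponent:
  assumes "composition \<alpha>" "i \<in> {1..length \<alpha>}"
  shows "h i \<in> Poly_Mapping.keys (exponent \<alpha> h)"
proof -
  have "0 < \<alpha> ! (i - 1)" using assms by (auto simp: composition_def)
  also have "\<dots> = Poly_Mapping.lookup (Poly_Mapping.single (h i) (\<alpha> ! (i - 1))) (h i)" by simp
  also have "\<dots> \<le> (\<Sum>j\<in>{1..length \<alpha>}. Poly_Mapping.lookup (Poly_Mapping.single (h j) (\<alpha> ! (j - 1))) (h i))"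
    using assms by (intro member_le_sum) auto
  also have "\<dots> = Poly_Mapping.lookup (exponent \<alpha> h) (h i)" by (simp only: exponent_def lookup_sum_mfps)
  finally show ?thesis by (simp add: in_keys_iff)
qed

section \<open>Coefficients of \<open>U\<close> by index sequences and signs\<close>

text \<open>Comparing neighbours suffices: \<open>signed_less\<close> is transitive, and a run of
  equal values has one sign, which makes \<open>\<pi>\<close> monotone along the run. Nonzero values
  and injectivity of \<open>\<pi>\<close> merge the two clauses of the definition into one
  equivalence.\<close>

lemma enriched_partition_perm_iff:
  assumes \<pi>: "\<pi> permutes {1..n}" and f: "f \<in> {1..n} \<rightarrow>\<^sub>E (UNIV - {0})"
  shows "f \<in> enriched_partitions n (perm_less n \<pi>) \<longleftrightarrow>
    (\<forall>i\<in>{1..<n}. signed_less (f (\<pi> i)) (f (\<pi> (i + 1))) \<or>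
       f (\<pi> i) = f (\<pi> (i + 1)) \<and> (f (\<pi> i) < 0 \<longleftrightarrow> \<pi> (i + 1) < \<pi> i))"
    (is "_ \<longleftrightarrow> (\<forall>i\<in>_. ?R i)")
proof -
  let ?Q = "\<lambda>i j. signed_less (f (\<pi> i)) (f (\<pi> j)) \<or>
     f (\<pi> i) = f (\<pi> j) \<and> (0 < f (\<pi> i) \<and> \<pi> i < \<pi> j \<or> f (\<pi> i) < 0 \<and> \<pi> j < \<pi> i)"
  have mem: "\<pi> i \<in> {1..n}" if "i \<in> {1..n}" for i using \<pi> that by (metis permutes_in_image)
  have nz: "f (\<pi> i) \<noteq> 0" if "i \<in> {1..n}" for i using f mem[OF that] by (auto simp: PiE_iff)
  have ne: "\<pi> i \<noteq> \<pi> j" if "i \<noteq> j" for i j using permutes_inj[OF \<pi>] that by (auto dest: injD)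
  have "f \<in> enriched_partitions n (perm_less n \<pi>) \<longleftrightarrow> (\<forall>i j. 1 \<le> i \<and> i < j \<and> j \<le> n \<longrightarrow> ?Q i j)"
    (is "?L \<longleftrightarrow> ?M")
  proof
    assume ?L
    then have L: "\<And>u v. u \<in> {1..n} \<Longrightarrow> v \<in> {1..n} \<Longrightarrow> perm_less n \<pi> u v \<Longrightarrow>
        (u < v \<longrightarrow> signed_less (f u) (f v) \<or> (f u = f v \<and> f u > 0)) \<and>
        (u > v \<longrightarrow> signed_less (f u) (f v) \<or> (f u = f v \<and> f u < 0))"
      by (auto simp: enriched_partitions_def)
    show ?M
    proof (intro allI impI)
      fix i j assume ij: "1 \<le> i \<and> i < j \<and> j \<le> n"
      then have "perm_less n \<pi> (\<pi> i) (\<pi> j)" by (auto simp: perm_less_def)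
      from L[OF mem mem this] ij ne[of i j] show "?Q i j" by (auto simp: nat_neq_iff)
    qed
  next
    assume M: ?M
    show ?L
      unfolding enriched_partitions_def
    proof (intro CollectI conjI ballI impI f)
      fix u v assume "perm_less n \<pi> u v"
      then obtain i j where ij: "1 \<le> i \<and> i < j \<and> j \<le> n" "u = \<pi> i" "v = \<pi> j"
        by (auto simp: perm_less_def)
      with M have Q: "?Q i j" by blast
      show "signed_less (f u) (f v) \<or> f u = f v \<and> f u > 0" if "u < v" using Q ij that by auto
      show "signed_less (f u) (f v) \<or> f u = f v \<and> f u < 0" if "u > v" using Q ij that by auto
    qed
  qed
  also have "\<dots> \<longleftrightarrow> (\<forall>i\<in>{1..<n}. ?Q i (i + 1))"
  proof
    assume M: "\<forall>i\<in>{1..<n}. ?Q i (i + 1)"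
    have "?Q i j" if "1 \<le> i" "i < j" "j \<le> n" for i j
      using \<open>i < j\<close> \<open>j \<le> n\<close>
    proof (induction j)
      case (Suc j)
      have step: "?Q j (j + 1)" if "i < j" using M Suc.prems \<open>1 \<le> i\<close> that by auto
      show ?case
      proof (cases "i = j")
        case True
        then show ?thesis using M Suc.prems \<open>1 \<le> i\<close> by auto
      next
        case False
        then have "i < j" "?Q i j" using Suc by auto
        with step show ?thesis by (auto simp: signed_less_def)
      qed
    qed simp
    then show "\<forall>i j. 1 \<le> i \<and> i < j \<and> j \<le> n \<longrightarrow> ?Q i j" by blast
  qed auto
  also have "\<dots> \<longleftrightarrow> (\<forall>i\<in>{1..<n}. ?R i)"
  proof (rule ball_cong[OF refl])
    fix i assume "i \<in> {1..<n}"
    then show "?Q i (i + 1) \<longleftrightarrow> ?R i" using nz[of i] ne[of i "i + 1"] by auto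
  qed
  finally show ?thesis .
qed


text \<open>Reindexing along \<open>\<pi>\<close> passes from labels to positions, where the weight
  of \<open>\<pi> i\<close> is simply \<open>\<alpha> ! (i - 1)\<close>.\<close>

lemma U_term_eq:
  assumes \<pi>: "\<pi> permutes {1..length \<alpha>}"
  shows "U_term q \<pi> \<alpha> f = mfps_smult (q ^ card {i \<in> {1..length \<alpha>}. f (\<pi> i) < 0})
    (mfps_monom (exponent \<alpha> (\<lambda>i. nat \<bar>f (\<pi> i)\<bar>)))"
proof -
  have "(\<Prod>i\<in>{1..length \<alpha>}. q ^ (if f i < 0 then 1 else 0)) =
      (\<Prod>i\<in>{1..length \<alpha>}. q ^ (if f (\<pi> i) < 0 then 1 else 0))"
    using prod.permute[OF \<pi>] by (simp add: comp_def)
  also have "\<dots> = q ^ card {i \<in> {1..length \<alpha>}. f (\<pi> i) < 0}"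
    by (simp add: power_sum[symmetric] sum.If_cases Int_def)
  finally have 1: "(\<Prod>i\<in>{1..length \<alpha>}. q ^ (if f i < 0 then 1 else 0)) = \<dots>" .
  have "(\<Sum>i\<in>{1..length \<alpha>}. Poly_Mapping.single (nat \<bar>f i\<bar>) (perm_weight \<pi> \<alpha> i)) =
      (\<Sum>i\<in>{1..length \<alpha>}. Poly_Mapping.single (nat \<bar>f (\<pi> i)\<bar>) (perm_weight \<pi> \<alpha> (\<pi> i)))"
    using sum.permute[OF \<pi>] by (simp add: comp_def)
  also have "\<dots> = exponent \<alpha> (\<lambda>i. nat \<bar>f (\<pi> i)\<bar>)"
    using permutes_inverses(2)[OF \<pi>] by (simp add: exponent_def perm_weight_def)
  finally show ?thesis by (simp only: U_term_def 1)
qed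

text \<open>The possible sets of positions that carry a minus sign, for descent set \<open>D\<close> and repetitions \<open>E\<close>.\<close>

definition sign_sets :: "nat \<Rightarrow> nat set \<Rightarrow> nat set \<Rightarrow> nat set set" where
  "sign_sets n D E = {S. S \<subseteq> {1..n} \<and> D \<inter> E \<subseteq> S \<and> S \<inter> Suc ` (E - D) = {}}"

text \<open>An enriched partition read along \<open>\<pi>\<close> amounts to its absolute values
  \<open>h\<close> and the set \<open>S\<close> of its negative positions. Signs are constrained
  only where \<open>h\<close> repeats, and there the constraints are those of
  \<open>sign_sets\<close>.\<close>

lemma coeff_U_sign_sets:
  assumes \<pi>: "\<pi> permutes {1..n}" and \<alpha>: "composition \<alpha>" "length \<alpha> = n"
  shows "mfps_coeff (U q \<pi> \<alpha>) m =
    (\<Sum>h\<in>index_maps \<alpha> m. \<Sum>S\<in>sign_sets n (Des n \<pi>) (repeats n h). q ^ card S)"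
proof -
  let ?Enr = "enriched_partitions n (perm_less n \<pi>)"
  let ?e = "\<lambda>f. exponent \<alpha> (\<lambda>i. nat \<bar>f (\<pi> i)\<bar>)"
  let ?neg = "\<lambda>f. {i \<in> {1..n}. f (\<pi> i) < (0::int)}"
  let ?F = "{f \<in> ?Enr. ?e f = m}"
  have \<pi>': "\<pi> permutes {1..length \<alpha>}" using \<pi> \<alpha> by simp
  have mem: "\<pi> i \<in> {1..n} \<longleftrightarrow> i \<in> {1..n}" for i using \<pi> by (rule permutes_in_image)
  have memi: "inv \<pi> i \<in> {1..n} \<longleftrightarrow> i \<in> {1..n}" for i
    using permutes_inv[OF \<pi>] by (rule permutes_in_image)
  have inv: "inv \<pi> (\<pi> i) = i" "\<pi> (inv \<pi> i) = i" for i using permutes_inverses[OF \<pi>] by auto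
  have coeff: "mfps_coeff (U_term q \<pi> \<alpha> f) m = (if ?e f = m then q ^ card (?neg f) else 0)"
    for q :: 'a and f
    using \<alpha> by (simp add: U_term_eq[OF \<pi>'] mfps_smult.rep_eq mfps_coeff_monom)
  \<comment> \<open>For general \<open>q\<close> a power may vanish. At \<open>q = 1\<close> the
    coefficient is nonzero exactly on \<open>?F\<close>, so summability there yields finiteness of
    \<open>?F\<close>.\<close>
  have "finite {f \<in> ?Enr. mfps_coeff (U_term (1::'a) \<pi> \<alpha> f) m \<noteq> 0}"
    using mfps_summable_U_term[OF \<pi>' \<alpha>(1)] \<alpha>(2) unfolding mfps_summable_def by blast
  also have "{f \<in> ?Enr. mfps_coeff (U_term (1::'a) \<pi> \<alpha> f) m \<noteq> 0} = ?F" by (auto simp: coeff)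
  finally have fin: "finite ?F" .
  have "mfps_coeff (U q \<pi> \<alpha>) m =
      (\<Sum>f | f \<in> ?Enr \<and> mfps_coeff (U_term q \<pi> \<alpha> f) m \<noteq> 0. mfps_coeff (U_term q \<pi> \<alpha> f) m)"
    using \<alpha> by (simp add: U_def mfps_sum.rep_eq)
  also have "\<dots> = (\<Sum>f\<in>?F. q ^ card (?neg f))"
    by (rule sum.mono_neutral_cong_left[OF fin]) (auto simp: coeff)
  also have "\<dots> = (\<Sum>(h, S)\<in>(SIGMA h:index_maps \<alpha> m. sign_sets n (Des n \<pi>) (repeats n h)). q ^ card S)"
  \<comment> \<open>Label \<open>u\<close> stands at position \<open>inv \<pi> u\<close>, from which
    the inverse map takes its sign and size.\<close>
  proof (rule sum.reindex_bij_witness[where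
        j = "\<lambda>f. (\<lambda>i\<in>{1..n}. nat \<bar>f (\<pi> i)\<bar>, ?neg f)" and
        i = "\<lambda>(h, S). \<lambda>u\<in>{1..n}. (if inv \<pi> u \<in> S then - 1 else 1) * int (h (inv \<pi> u))"])
    fix f assume f: "f \<in> ?F"
    then have ext: "f \<in> {1..n} \<rightarrow>\<^sub>E (UNIV - {0})" by (simp add: enriched_partitions_def)
    have nz: "f (\<pi> i) \<noteq> 0" if "i \<in> {1..n}" for i
      using ext that mem by (auto simp: PiE_iff)
    let ?h = "\<lambda>i\<in>{1..n}. nat \<bar>f (\<pi> i)\<bar>"
    show "(case (?h, ?neg f) of (h, S) \<Rightarrow>
        \<lambda>u\<in>{1..n}. (if inv \<pi> u \<in> S then - 1 else 1) * int (h (inv \<pi> u))) = f"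
      using ext memi by (auto simp: fun_eq_iff inv PiE_iff extensional_def)
    have e: "exponent \<alpha> ?h = m" using f \<alpha> by (auto simp: exponent_def)
    have step: "signed_less (f (\<pi> i)) (f (\<pi> (i + 1))) \<or>
       f (\<pi> i) = f (\<pi> (i + 1)) \<and> (f (\<pi> i) < 0 \<longleftrightarrow> \<pi> (i + 1) < \<pi> i)" if "i \<in> {1..<n}" for i
      using f enriched_partition_perm_iff[OF \<pi> ext] that by blast
    have "?h \<in> index_maps \<alpha> m"
      unfolding index_maps_def
    proof (intro CollectI conjI PiE_I ballI e)
      fix i assume "i \<in> {1..length \<alpha>}"
      then show "?h i \<in> Poly_Mapping.keys m - {0}"
        using keys_exponent[OF \<alpha>(1), of i ?h] e nz[of i] \<alpha>(2) by auto
    next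
      fix i assume "i \<in> {1..<length \<alpha>}"
      then show "?h i \<le> ?h (i + 1)" using step[of i] \<alpha>(2) by (auto simp: signed_less_def)
    qed (use \<alpha> in auto)
    moreover have "?neg f \<in> sign_sets n (Des n \<pi>) (repeats n ?h)"
      unfolding sign_sets_def
    proof (intro CollectI conjI)
      \<comment> \<open>For equal absolute values, \<open>signed_less\<close> means minus followed
        by plus, while equal values at a descent are negative; either way position \<open>i\<close>
        is negative.\<close>
      show "Des n \<pi> \<inter> repeats n ?h \<subseteq> ?neg f"
      proof
        fix i assume i: "i \<in> Des n \<pi> \<inter> repeats n ?h"
        then have "i \<in> {1..<n}" by (auto simp: repeats_def)
        with i step[OF this] nz[of i] nz[of "i + 1"] show "i \<in> ?neg f"
          by (auto simp: signed_less_def repeats_def Des_def)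
      qed
      \<comment> \<open>By the same dichotomy, the position after an ascent in a repetition is
        positive.\<close>
      have "\<not> f (\<pi> (i + 1)) < 0" if i: "i \<in> repeats n ?h - Des n \<pi>" for i
      proof -
        have "i \<in> {1..<n}" using i by (auto simp: repeats_def)
        with i step[OF this] nz[of i] nz[of "i + 1"] show ?thesis
          by (auto simp: signed_less_def repeats_def Des_def)
      qed
      then show "?neg f \<inter> Suc ` (repeats n ?h - Des n \<pi>) = {}" by auto
    qed auto
    ultimately show "(?h, ?neg f) \<in> (SIGMA h:index_maps \<alpha> m. sign_sets n (Des n \<pi>) (repeats n h))"
      by blast
    show "(case (?h, ?neg f) of (h, S) \<Rightarrow> q ^ card S) = q ^ card (?neg f)" by simp
  next
    fix p assume "p \<in> (SIGMA h:index_maps \<alpha> m. sign_sets n (Des n \<pi>) (repeats n h))"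
    then obtain h S where p: "p = (h, S)" and h: "h \<in> index_maps \<alpha> m"
      and S: "S \<in> sign_sets n (Des n \<pi>) (repeats n h)" by blast
    define f where "f = (\<lambda>u\<in>{1..n}. (if inv \<pi> u \<in> S then - 1 else 1) * int (h (inv \<pi> u)))"
    have f\<pi>: "f (\<pi> i) = (if i \<in> S then - 1 else 1) * int (h i)" if "i \<in> {1..n}" for i
      using that mem[of i] unfolding f_def by (simp add: inv)
    have pos: "h i > 0" if "i \<in> {1..n}" for i
      using h that \<alpha> by (auto simp: index_maps_def PiE_iff)
    have hext: "h i = undefined" if "i \<notin> {1..n}" for i
      using h that \<alpha> by (auto simp: index_maps_def PiE_iff extensional_def)
    have S_sub: "S \<subseteq> {1..n}" using S by (auto simp: sign_sets_def)
    have "f u \<noteq> 0" if "u \<in> {1..n}" for u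
      using that pos[of "inv \<pi> u"] memi[of u] by (simp add: f_def)
    then have ext: "f \<in> {1..n} \<rightarrow>\<^sub>E (UNIV - {0})" by (auto simp: f_def)
    have "f \<in> ?Enr"
      unfolding enriched_partition_perm_iff[OF \<pi> ext]
    proof
      fix i assume i: "i \<in> {1..<n}"
      then have le: "h i \<le> h (i + 1)" using h \<alpha> by (auto simp: index_maps_def)
      have sgn: "i \<in> S" if "h i = h (i + 1)" "\<pi> (i + 1) < \<pi> i"
        using S i that by (auto simp: sign_sets_def repeats_def Des_def)
      have sgn': "i + 1 \<notin> S" if "h i = h (i + 1)" "\<not> \<pi> (i + 1) < \<pi> i"
        using S i that by (auto simp: sign_sets_def repeats_def Des_def disjoint_iff)
      have vals: "f (\<pi> i) = (if i \<in> S then - 1 else 1) * int (h i)"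
        "f (\<pi> (i + 1)) = (if i + 1 \<in> S then - 1 else 1) * int (h (i + 1))" "0 < h (i + 1)"
        using i pos[of "i + 1"] by (auto simp: f\<pi>)
      show "signed_less (f (\<pi> i)) (f (\<pi> (i + 1))) \<or>
         f (\<pi> i) = f (\<pi> (i + 1)) \<and> (f (\<pi> i) < 0 \<longleftrightarrow> \<pi> (i + 1) < \<pi> i)"
      \<comment> \<open>Where \<open>h\<close> increases, the order ignores signs. At a repeated
        descent the left value is negative, at a repeated ascent the right one is positive; the
        other sign decides between equality and \<open>signed_less\<close>.\<close>
      proof (cases "h i = h (i + 1)")
        case True
        show ?thesis
        proof (cases "\<pi> (i + 1) < \<pi> i")
          case True
          then show ?thesis
            using vals sgn \<open>h i = h (i + 1)\<close> by (simp add: signed_less_def abs_mult)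
        next
          case False
          then show ?thesis
            using vals sgn' \<open>h i = h (i + 1)\<close> by (simp add: signed_less_def abs_mult)
        qed
      next
        case False
        with le show ?thesis unfolding vals signed_less_def by (simp add: abs_mult)
      qed
    qed
    moreover have "?e f = exponent \<alpha> h"
      unfolding exponent_def using \<alpha> by (intro sum.cong) (auto simp: f\<pi> abs_mult)
    then have "?e f = m" using h by (simp add: index_maps_def)
    ultimately show "(case p of (h, S) \<Rightarrow>
        \<lambda>u\<in>{1..n}. (if inv \<pi> u \<in> S then - 1 else 1) * int (h (inv \<pi> u))) \<in> ?F"
      by (simp add: p f_def)
    have "(\<lambda>i\<in>{1..n}. nat \<bar>f (\<pi> i)\<bar>) = h"
      by (auto simp: fun_eq_iff f\<pi> hext abs_mult)
    moreover have "?neg f = S"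
      using S_sub pos by (auto simp: f\<pi> split: if_splits)
    ultimately show "(\<lambda>i\<in>{1..n}. nat \<bar>(case p of (h, S) \<Rightarrow>
        \<lambda>u\<in>{1..n}. (if inv \<pi> u \<in> S then - 1 else 1) * int (h (inv \<pi> u))) (\<pi> i)\<bar>,
        ?neg (case p of (h, S) \<Rightarrow>
        \<lambda>u\<in>{1..n}. (if inv \<pi> u \<in> S then - 1 else 1) * int (h (inv \<pi> u)))) = p"
      by (simp only: p prod.case flip: f_def)
  qed
  also have "\<dots> = (\<Sum>h\<in>index_maps \<alpha> m. \<Sum>S\<in>sign_sets n (Des n \<pi>) (repeats n h). q ^ card S)"
    by (rule sum.Sigma[symmetric]) (auto simp: finite_index_maps sign_sets_def)
  finally show ?thesis .
qed

text \<open>The shift by \<open>Suc\<close> is injective, so forced minus and plus signs together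
  number \<open>card E\<close>, which leaves \<open>n - card E\<close> free signs. A position forced
  both ways admits no sign set at all.\<close>

lemma coeff_U:
  assumes "\<pi> permutes {1..n}" "composition \<alpha>" "length \<alpha> = n"
  shows "mfps_coeff (U q \<pi> \<alpha>) m =
    (\<Sum>h\<in>index_maps \<alpha> m. let E = repeats n h; D = Des n \<pi> in
       if D \<inter> E \<inter> Suc ` (E - D) = {} then q ^ card (D \<inter> E) * (1 + q) ^ (n - card E) else 0)"
  unfolding coeff_U_sign_sets[OF assms] Let_def
proof (rule sum.cong[OF refl])
  fix h
  let ?E = "repeats n h" and ?D = "Des n \<pi>"
  have "card (?D \<inter> ?E) + card (Suc ` (?E - ?D)) = card ((?D \<inter> ?E) \<union> (?E - ?D))"
    by (subst card_Un_disjoint) (auto simp: card_image)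
  also have "(?D \<inter> ?E) \<union> (?E - ?D) = ?E" by blast
  finally have *: "card (?D \<inter> ?E) + card (Suc ` (?E - ?D)) = card ?E" .
  have "Suc ` (?E - ?D) \<subseteq> {1..n}" "?D \<inter> ?E \<subseteq> {1..n}" by (auto simp: repeats_def)
  then show "(\<Sum>S\<in>sign_sets n ?D ?E. q ^ card S) =
      (if ?D \<inter> ?E \<inter> Suc ` (?E - ?D) = {} then q ^ card (?D \<inter> ?E) * (1 + q) ^ (n - card ?E) else 0)"
    unfolding sign_sets_def by (subst sum_between_sets) (auto simp: *)
qed

text \<open>The identity has no descents, so no minus sign is forced and no conflict can
  occur.\<close>

lemma coeff_eta:
  assumes "composition \<beta>"
  shows "mfps_coeff (eta q \<beta>) m =
    (\<Sum>h\<in>index_maps \<beta> m. (1 + q) ^ (length \<beta> - card (repeats (length \<beta>) h)))"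
  unfolding eta_def
  by (subst coeff_U[OF permutes_id assms refl]) (simp add: Des_def Let_def)


section \<open>Merging entries and repeating indices\<close>

lemma length_merge_at:
  assumes "1 \<le> i" "i < length \<beta>"
  shows "length (merge_at \<beta> i) = length \<beta> - 1"
  using assms by (auto simp: merge_at_def)

lemma nth_merge_at:
  assumes "1 \<le> i" "i < length \<beta>" "1 \<le> j" "j \<le> length \<beta> - 1"
  shows "merge_at \<beta> i ! (j - 1) =
    \<beta> ! ((if j \<le> i then j else j + 1) - 1) + (if j = i then \<beta> ! i else 0)"
  using assms by (auto simp: merge_at_def nth_append min_def nth_Cons' intro!: arg_cong[of _ _ "(!) \<beta>"])

text \<open>As \<open>h\<close> takes the value \<open>h' i\<close> at both \<open>i\<close> and
  \<open>i + 1\<close>, the two merged entries belong to the same indeterminate and their exponents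
  add.\<close>

lemma exponent_merge_at:
  assumes i: "1 \<le> i" "i < length \<beta>"
    and h: "\<And>j. 1 \<le> j \<Longrightarrow> j \<le> length \<beta> \<Longrightarrow> h j = h' (if j \<le> i then j else j - 1)"
  shows "exponent \<beta> h = exponent (merge_at \<beta> i) h'"
proof -
  let ?k = "length \<beta>" and ?s = "\<lambda>j. if j \<le> i then j else j + 1"
  let ?g = "\<lambda>j. Poly_Mapping.single (h j) (\<beta> ! (j - 1))"
  \<comment> \<open>The map \<open>?s\<close> enumerates all positions but \<open>i + 1\<close>,
    whose term is split off and later joined to the term of \<open>i\<close>.\<close>
  have dom: "{1..?k} = insert (i + 1) (?s ` {1..?k - 1})"
  proof
    show "{1..?k} \<subseteq> insert (i + 1) (?s ` {1..?k - 1})"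
    proof
      fix j assume j: "j \<in> {1..?k}"
      show "j \<in> insert (i + 1) (?s ` {1..?k - 1})"
      proof (cases "j \<le> i")
        case True
        then show ?thesis using i j by (intro insertI2 image_eqI[of _ _ j]) auto
      next
        case False
        then show ?thesis using i j by (cases "j = i + 1") (auto intro!: image_eqI[of _ _ "j - 1"])
      qed
    qed
  qed (use i in auto)
  have inj: "inj_on ?s {1..?k - 1}" by (auto simp: inj_on_def split: if_splits)
  have "exponent \<beta> h = ?g (i + 1) + (\<Sum>j\<in>?s ` {1..?k - 1}. ?g j)"
    unfolding exponent_def dom by (subst sum.insert) (auto split: if_splits)
  also have "(\<Sum>j\<in>?s ` {1..?k - 1}. ?g j) = (\<Sum>j\<in>{1..?k - 1}. ?g (?s j))"
    by (rule sum.reindex[OF inj, unfolded comp_def])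
  also have "?g (i + 1) = (\<Sum>j\<in>{1..?k - 1}. if j = i then Poly_Mapping.single (h' i) (\<beta> ! i) else 0)"
    using i h[of "i + 1"] by (simp add: le_diff_conv2)
  also have "\<dots> + (\<Sum>j\<in>{1..?k - 1}. ?g (?s j)) = exponent (merge_at \<beta> i) h'"
    unfolding exponent_def length_merge_at[OF i] sum.distrib[symmetric]
  proof (rule sum.cong[OF refl])
    fix j assume j: "j \<in> {1..?k - 1}"
    then have "h (?s j) = h' j" using h[of "?s j"] i by auto
    then show "(if j = i then Poly_Mapping.single (h' i) (\<beta> ! i) else 0) + ?g (?s j) =
        Poly_Mapping.single (h' j) (merge_at \<beta> i ! (j - 1))"
      using j nth_merge_at[OF i, of j] by (auto simp: single_add add.commute)
  qed
  finally show ?thesis .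
qed

text \<open>Doubling the value at \<open>i\<close> creates a repetition at \<open>i\<close>. Earlier
  repetitions stay; those from \<open>i\<close> onwards, including one at \<open>i\<close> itself,
  move up by one.\<close>

lemma repeats_merge:
  assumes i: "1 \<le> i" "i < k"
    and h: "\<And>j. 1 \<le> j \<Longrightarrow> j \<le> k \<Longrightarrow> h j = h' (if j \<le> i then j else j - 1)"
  shows "repeats k h = insert i ((\<lambda>j. if j < i then j else j + 1) ` repeats (k - 1) h')"
proof (rule set_eqI)
  fix j
  consider "j < i" | "j = i" | "i < j" by linarith
  then show "j \<in> repeats k h \<longleftrightarrow> j \<in> insert i ((\<lambda>j. if j < i then j else j + 1) ` repeats (k - 1) h')"
  proof cases
    case 3
    then have "j \<in> repeats k h \<longleftrightarrow> j - 1 \<in> repeats (k - 1) h'"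
      using i h[of j] h[of "j + 1"] by (auto simp: repeats_def)
    then show ?thesis using 3 by (auto simp: image_iff intro!: bexI[of _ "j - 1"])
  qed (use i h[of j] h[of "j + 1"] in \<open>auto simp: repeats_def image_iff\<close>)
qed

text \<open>Doubling the value at \<open>i\<close> is a bijection onto the sequences repeating at
  \<open>i\<close>. Length and number of repetitions both grow by one, so the exponent of
  \<open>w\<close> is unchanged; \<open>K\<close> lies below \<open>i\<close> and is not
  shifted.\<close>

lemma sum_index_maps_merge_at:
  assumes i: "1 \<le> i" "i < length \<beta>" and K: "K \<subseteq> {1..<i}"
  shows "(\<Sum>h | h \<in> index_maps (merge_at \<beta> i) m \<and> K \<subseteq> repeats (length (merge_at \<beta> i)) h.
      (w :: 'a::comm_ring_1) ^ (length (merge_at \<beta> i) - card (repeats (length (merge_at \<beta> i)) h))) =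
    (\<Sum>h | h \<in> index_maps \<beta> m \<and> insert i K \<subseteq> repeats (length \<beta>) h.
      w ^ (length \<beta> - card (repeats (length \<beta>) h)))"
proof -
  let ?k = "length \<beta>"
  let ?up = "\<lambda>h. \<lambda>j\<in>{1..?k}. h (if j \<le> i then j else j - 1) :: nat"
  let ?down = "\<lambda>h. \<lambda>j\<in>{1..?k - 1}. h (if j \<le> i then j else j + 1) :: nat"
  let ?s = "\<lambda>j. if j < i then j else j + 1"
  have rep: "repeats ?k (?up h) = insert i (?s ` repeats (?k - 1) h)" for h
    using i by (intro repeats_merge) auto
  have card: "card (repeats ?k (?up h)) = card (repeats (?k - 1) h) + 1" for h
  proof -
    have "inj_on ?s (repeats (?k - 1) h)" by (auto simp: inj_on_def split: if_splits)
    then have "card (?s ` repeats (?k - 1) h) = card (repeats (?k - 1) h)" by (rule card_image)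
    moreover have "i \<notin> ?s ` repeats (?k - 1) h" by (auto split: if_splits)
    ultimately show ?thesis unfolding rep by simp
  qed
  have K_iff: "insert i K \<subseteq> repeats ?k (?up h) \<longleftrightarrow> K \<subseteq> repeats (?k - 1) h" for h
  proof -
    have "j \<in> repeats ?k (?up h) \<longleftrightarrow> j \<in> repeats (?k - 1) h" if "j \<in> K" for j
      using that K unfolding rep by (auto simp: image_iff)
    moreover have "i \<in> repeats ?k (?up h)" unfolding rep by (rule insertI1)
    ultimately show ?thesis by blast
  qed
  have exp: "exponent \<beta> (?up h) = exponent (merge_at \<beta> i) h" for h
    using i by (intro exponent_merge_at) auto
  have up_down: "?up (?down h) = h" if "h \<in> index_maps \<beta> m" "i \<in> repeats ?k h" for h
  proof
    fix j
    have "h (i + 1) = h i" using that by (simp add: repeats_def)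
    moreover have "h j = undefined" if "j \<notin> {1..?k}"
      using \<open>h \<in> index_maps \<beta> m\<close> that by (auto simp: index_maps_def PiE_iff extensional_def)
    ultimately show "?up (?down h) j = h j"
      using i by (cases "j = i + 1") auto
  qed
  have down_up: "?down (?up h) = h" if "h \<in> index_maps (merge_at \<beta> i) m" for h
  proof
    fix j
    have "h j = undefined" if "j \<notin> {1..?k - 1}"
      using \<open>h \<in> index_maps (merge_at \<beta> i) m\<close> that length_merge_at[OF i]
      by (auto simp: index_maps_def PiE_iff extensional_def)
    then show "?down (?up h) j = h j" using i by auto
  qed
  have up_in: "?up h \<in> index_maps \<beta> m" if h: "h \<in> index_maps (merge_at \<beta> i) m" for h
    unfolding index_maps_def
  proof (intro CollectI conjI PiE_I ballI)
    show "exponent \<beta> (?up h) = m" using h exp by (simp add: index_maps_def)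
    show "?up h j \<in> Poly_Mapping.keys m - {0}" if "j \<in> {1..?k}" for j
    proof -
      have "(if j \<le> i then j else j - 1) \<in> {1..?k - 1}" using that i by auto
      then show ?thesis using h that length_merge_at[OF i] by (auto simp: index_maps_def PiE_iff)
    qed
    show "?up h j \<le> ?up h (j + 1)" if "j \<in> {1..<?k}" for j
    proof -
      have "h l \<le> h (l + 1)" if "1 \<le> l" "l < ?k - 1" for l
        using h that length_merge_at[OF i] by (auto simp: index_maps_def)
      from this[of j] this[of "j - 1"] show ?thesis using that i by auto
    qed
  qed auto
  have down_in: "?down h \<in> index_maps (merge_at \<beta> i) m"
    if h: "h \<in> index_maps \<beta> m" "i \<in> repeats ?k h" for h
    unfolding index_maps_def length_merge_at[OF i]
  proof (intro CollectI conjI PiE_I ballI)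
    show "exponent (merge_at \<beta> i) (?down h) = m"
      using h exp[of "?down h"] up_down[OF h] by (simp add: index_maps_def)
    show "?down h j \<in> Poly_Mapping.keys m - {0}" if "j \<in> {1..?k - 1}" for j
    proof -
      have "(if j \<le> i then j else j + 1) \<in> {1..?k}" using that i by auto
      then show ?thesis using h that by (auto simp: index_maps_def PiE_iff)
    qed
    show "?down h j \<le> ?down h (j + 1)" if "j \<in> {1..<?k - 1}" for j
    proof -
      have "h l \<le> h (l + 1)" if "1 \<le> l" "l < ?k" for l
        using h that by (auto simp: index_maps_def)
      \<comment> \<open>For \<open>j = i\<close> the map \<open>?down\<close> skips position
        \<open>i + 1\<close>, so two consecutive inequalities are chained.\<close>
      then have "h j \<le> h (j + 1)" "h (j + 1) \<le> h (j + 2)" using that by auto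
      then show ?thesis using that i by auto
    qed
  qed auto
  show ?thesis
    unfolding length_merge_at[OF i]
  proof (rule sum.reindex_bij_witness[where i = ?down and j = ?up])
    fix h assume h: "h \<in> {h. h \<in> index_maps (merge_at \<beta> i) m \<and> K \<subseteq> repeats (?k - 1) h}"
    then show "?down (?up h) = h" by (intro down_up) simp
    show "?up h \<in> {h. h \<in> index_maps \<beta> m \<and> insert i K \<subseteq> repeats ?k h}"
      using h up_in K_iff by blast
    show "w ^ (?k - card (repeats ?k (?up h))) = w ^ (?k - 1 - card (repeats (?k - 1) h))"
      unfolding card by (simp add: add.commute)
  next
    fix h assume "h \<in> {h. h \<in> index_maps \<beta> m \<and> insert i K \<subseteq> repeats ?k h}"
    then have h: "h \<in> index_maps \<beta> m" "insert i K \<subseteq> repeats ?k h" "i \<in> repeats ?k h" by auto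
    show "?up (?down h) = h" by (rule up_down[OF h(1,3)])
    have "K \<subseteq> repeats (?k - 1) (?down h)"
      using K_iff[of "?down h"] h(2) unfolding up_down[OF h(1,3)] by blast
    then show "?down h \<in> {h. h \<in> index_maps (merge_at \<beta> i) m \<and> K \<subseteq> repeats (?k - 1) h}"
      using down_in[OF h(1,3)] by blast
  qed
qed

text \<open>Distinct numbers strictly between \<open>i\<close> and \<open>n\<close> number at most
  \<open>n - i - 1\<close>. Hence, after one merge for each of them, position \<open>i\<close> can
  still be merged with its successor.\<close>

lemma sorted_length_less:
  assumes "sorted_wrt (<) xs" "set xs \<subseteq> {i<..<(n::nat)}" "i < n"
  shows "length xs + i < n"
proof -
  have "length xs = card (set xs)" using assms(1) by (simp add: distinct_card strict_sorted_iff)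
  also have "\<dots> \<le> card {i<..<n}" using assms(2) by (intro card_mono) auto
  finally show ?thesis using assms(3) by simp
qed

lemma length_foldr_merge_at:
  assumes "sorted_wrt (<) xs" "set xs \<subseteq> {1..<length \<beta>}"
  shows "length (foldr (\<lambda>i \<beta>. merge_at \<beta> i) xs \<beta>) = length \<beta> - length xs"
  using assms
proof (induction xs)
  case (Cons i xs)
  have "length xs + i < length \<beta>" by (rule sorted_length_less) (use Cons.prems in auto)
  then show ?case using Cons length_merge_at[of i "foldr (\<lambda>i \<beta>. merge_at \<beta> i) xs \<beta>"] by simp
qed simp

lemma composition_foldr_merge_at:
  assumes "sorted_wrt (<) xs" "set xs \<subseteq> {1..<length \<beta>}" "composition \<beta>"
  shows "composition (foldr (\<lambda>i \<beta>. merge_at \<beta> i) xs \<beta>)"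
  using assms
proof (induction xs)
  case (Cons i xs)
  let ?\<gamma> = "foldr (\<lambda>i \<beta>. merge_at \<beta> i) xs \<beta>"
  have "length xs + i < length \<beta>" by (rule sorted_length_less) (use Cons.prems in auto)
  then have "i < length ?\<gamma>" using Cons.prems length_foldr_merge_at[of xs \<beta>] by simp
  moreover have "composition ?\<gamma>" using Cons by simp
  ultimately show ?case
    by (auto simp: composition_def merge_at_def dest: in_set_takeD in_set_dropD)
qed simp

text \<open>The head of \<open>xs\<close> is merged last, so the induction undoes it first and moves
  it into \<open>K\<close>. The set \<open>K\<close> must vary: it collects the repetitions already
  demanded, all below the positions still in the list.\<close>

lemma sum_index_maps_foldr_merge_at:
  fixes w :: "'a::comm_ring_1"
  assumes "sorted_wrt (<) xs" "set xs \<subseteq> {1..<length \<beta>}" "\<forall>x\<in>set xs. K \<subseteq> {1..<x}"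
  shows "(let \<gamma> = foldr (\<lambda>i \<beta>. merge_at \<beta> i) xs \<beta>; k = length \<gamma> in
      \<Sum>h | h \<in> index_maps \<gamma> m \<and> K \<subseteq> repeats k h. w ^ (k - card (repeats k h))) =
    (\<Sum>h | h \<in> index_maps \<beta> m \<and> K \<union> set xs \<subseteq> repeats (length \<beta>) h.
      w ^ (length \<beta> - card (repeats (length \<beta>) h)))"
  using assms
proof (induction xs arbitrary: K)
  case (Cons i xs)
  let ?\<gamma> = "foldr (\<lambda>i \<beta>. merge_at \<beta> i) xs \<beta>"
  have "length xs + i < length \<beta>" by (rule sorted_length_less) (use Cons.prems in auto)
  then have "i < length ?\<gamma>" using Cons.prems length_foldr_merge_at[of xs \<beta>] by simp
  moreover have "1 \<le> i" "K \<subseteq> {1..<i}" using Cons.prems by auto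
  ultimately show ?case
    using Cons.IH[of "insert i K"] Cons.prems sum_index_maps_merge_at[of i ?\<gamma> K w m]
    by (fastforce simp: Let_def)
qed (simp add: Let_def)

text \<open>This expresses every merged \<eta> through sequences for the single composition
  \<open>\<alpha>\<close>, as needed for the comparison with \<open>coeff_U\<close>.\<close>

lemma coeff_eta_merge_set:
  assumes "composition \<alpha>" "K \<subseteq> {1..<length \<alpha>}"
  shows "mfps_coeff (eta q (merge_set \<alpha> K)) m =
    (\<Sum>h | h \<in> index_maps \<alpha> m \<and> K \<subseteq> repeats (length \<alpha>) h.
      (1 + q) ^ (length \<alpha> - card (repeats (length \<alpha>) h)))"
proof -
  let ?xs = "sorted_list_of_set K"
  have "finite K" using assms finite_subset by blast
  then have xs: "sorted_wrt (<) ?xs" "set ?xs \<subseteq> {1..<length \<alpha>}" "set ?xs = K" using assms by auto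
  then show ?thesis
    using coeff_eta[OF composition_foldr_merge_at[OF xs(1,2) assms(1)], of q m]
      sum_index_maps_foldr_merge_at[OF xs(1,2), of "{}" "1 + q" m]
    by (simp add: merge_set_def Let_def)
qed

section \<open>Comparison of the two sides\<close>

lemma mfps_coeff_sum: "mfps_coeff (sum F A) m = (\<Sum>a\<in>A. mfps_coeff (F a) m)"
  by (induction A rule: infinite_finite_induct) (simp_all add: zero_mfps.rep_eq plus_mfps.rep_eq)

text \<open>A peak \<open>j\<close> with \<open>j - 1\<close> and \<open>j\<close> in
  \<open>E\<close> is a descent in \<open>E\<close> whose predecessor is an ascent in
  \<open>E\<close>. This gives the summation range the form of \<open>sum_disjoint_pairs\<close>,
  with the conflict set of \<open>coeff_U\<close> in the role of \<open>P\<close>.\<close>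

lemma descent_peak_pairs_eq:
  assumes \<pi>: "\<pi> permutes {1..n}" and E: "E \<subseteq> {1..<n}"
  defines "D \<equiv> Des n \<pi>"
  shows "{(I, J). (I \<subseteq> D \<and> J \<subseteq> Peak n \<pi> \<and> I \<inter> J = {}) \<and> I \<union> J \<union> (\<lambda>j. j - 1) ` J \<subseteq> E} =
    {(I, J). I \<subseteq> D \<inter> E \<and> J \<subseteq> D \<inter> E \<inter> Suc ` (E - D) \<and> I \<inter> J = {}}"
proof -
  have peak_iff: "j \<in> Peak n \<pi> \<and> j \<in> E \<and> j - 1 \<in> E \<longleftrightarrow> j \<in> D \<inter> E \<inter> Suc ` (E - D)" for j
  proof
    assume j: "j \<in> Peak n \<pi> \<and> j \<in> E \<and> j - 1 \<in> E"
    then have "j = Suc (j - 1)" "j - 1 \<in> E - D" by (auto simp: Peak_def D_def Des_def)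
    then have "j \<in> Suc ` (E - D)" by blast
    then show "j \<in> D \<inter> E \<inter> Suc ` (E - D)" using j by (auto simp: Peak_def D_def Des_def)
  next
    assume "j \<in> D \<inter> E \<inter> Suc ` (E - D)"
    then obtain i where i: "j = Suc i" "i \<in> E" "i \<notin> D" "j \<in> D" "j \<in> E" by auto
    then have "1 \<le> i" "i < n" using E by auto
    \<comment> \<open>Injectivity turns a position that is not a descent into a strict ascent, as a
      peak requires.\<close>
    moreover have "\<pi> i \<noteq> \<pi> (Suc i)" using permutes_inj[OF \<pi>] by (simp add: inj_eq)
    ultimately show "j \<in> Peak n \<pi> \<and> j \<in> E \<and> j - 1 \<in> E"
      using i by (auto simp: Peak_def D_def Des_def)
  qed
  have J_iff: "J \<subseteq> Peak n \<pi> \<and> J \<subseteq> E \<and> (\<lambda>j. j - 1) ` J \<subseteq> E \<longleftrightarrow> J \<subseteq> D \<inter> E \<inter> Suc ` (E - D)" for J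
  proof -
    have "J \<subseteq> Peak n \<pi> \<and> J \<subseteq> E \<and> (\<lambda>j. j - 1) ` J \<subseteq> E \<longleftrightarrow>
        (\<forall>j\<in>J. j \<in> Peak n \<pi> \<and> j \<in> E \<and> j - 1 \<in> E)"
      by blast
    also have "\<dots> \<longleftrightarrow> J \<subseteq> D \<inter> E \<inter> Suc ` (E - D)"
      unfolding peak_iff subset_eq ..
    finally show ?thesis .
  qed
  have "(I \<subseteq> D \<and> J \<subseteq> Peak n \<pi> \<and> I \<inter> J = {}) \<and> I \<union> J \<union> (\<lambda>j. j - 1) ` J \<subseteq> E \<longleftrightarrow>
      I \<subseteq> D \<inter> E \<and> J \<subseteq> D \<inter> E \<inter> Suc ` (E - D) \<and> I \<inter> J = {}" for I J
    using J_iff[of J] unfolding Un_subset_iff Int_subset_iff by argo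
  then show ?thesis by (simp only:)
qed

theorem theorem3p4:
  fixes q :: "'k::comm_ring_1" and n :: nat and \<pi> :: "nat \<Rightarrow> nat" and \<alpha> :: "nat list"
  assumes "\<pi> permutes {1..n}"
    and "composition \<alpha>" and "length \<alpha> = n"
  shows "U q \<pi> \<alpha> =
    (\<Sum>(I, J)\<in>{(I, J). I \<subseteq> Des n \<pi> \<and> J \<subseteq> Peak n \<pi> \<and> I \<inter> J = {}}.
      mfps_smult ((- q) ^ card J * (q - 1) ^ card I) (eta q (merge_set2 \<alpha> I J)))"
proof (rule mfps_eqI)
  fix m
  let ?D = "Des n \<pi>" and ?E = "\<lambda>h. repeats n h"
  let ?P = "{(I, J). I \<subseteq> ?D \<and> J \<subseteq> Peak n \<pi> \<and> I \<inter> J = {}}"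
  let ?K = "\<lambda>(I, J). I \<union> J \<union> (\<lambda>j. j - 1) ` J"
  let ?c = "\<lambda>(I, J). (- q) ^ card J * (q - 1) ^ card I"
  let ?w = "\<lambda>h. (1 + q) ^ (n - card (?E h))"
  have "?P \<subseteq> Pow {1..n} \<times> Pow {1..n}" by (auto simp: Des_def Peak_def)
  then have finP: "finite ?P" by (rule finite_subset) simp
  have coeff: "mfps_coeff (eta q (merge_set2 \<alpha> I J)) m =
      (\<Sum>h | h \<in> index_maps \<alpha> m \<and> ?K (I, J) \<subseteq> ?E h. ?w h)" if "(I, J) \<in> ?P" for I J
  proof -
    \<comment> \<open>Peaks start at 2, so \<open>j - 1\<close> is still a valid position for
      merging.\<close>
    have "?D \<subseteq> {1..<n}" "Peak n \<pi> \<subseteq> {2..<n}" by (auto simp: Des_def Peak_def)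
    then have "I \<subseteq> {1..<n}" "J \<subseteq> {2..<n}" using that by blast+
    then have "?K (I, J) \<subseteq> {1..<length \<alpha>}" using assms(3) by force
    then show ?thesis
      using coeff_eta_merge_set[OF assms(2), of "?K (I, J)" q m] assms(3) by (simp add: merge_set2_def)
  qed
  have "mfps_coeff (\<Sum>(I, J)\<in>?P. mfps_smult ((- q) ^ card J * (q - 1) ^ card I) (eta q (merge_set2 \<alpha> I J))) m =
      (\<Sum>p\<in>?P. \<Sum>h | h \<in> index_maps \<alpha> m \<and> ?K p \<subseteq> ?E h. ?c p * ?w h)"
    unfolding mfps_coeff_sum
    by (rule sum.cong[OF refl]) (auto simp: mfps_smult.rep_eq coeff sum_distrib_left)
  \<comment> \<open>Exchanging the sums fixes \<open>h\<close>, so that its total weight over all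
    pairs \<open>(I, J)\<close> can be compared with its weight in \<open>U\<close>.\<close>
  also have "\<dots> = (\<Sum>h\<in>index_maps \<alpha> m. \<Sum>p | p \<in> ?P \<and> ?K p \<subseteq> ?E h. ?c p * ?w h)"
    by (rule sum.swap_restrict[OF finP finite_index_maps])
  also have "\<dots> = mfps_coeff (U q \<pi> \<alpha>) m"
    unfolding coeff_U[OF assms] Let_def
  proof (rule sum.cong[OF refl])
    fix h
    let ?A = "?D \<inter> ?E h"
    let ?B = "?A \<inter> Suc ` (?E h - ?D)"
    have "{p. p \<in> ?P \<and> ?K p \<subseteq> ?E h} =
        {(I, J). (I \<subseteq> ?D \<and> J \<subseteq> Peak n \<pi> \<and> I \<inter> J = {}) \<and> I \<union> J \<union> (\<lambda>j. j - 1) ` J \<subseteq> ?E h}"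
    proof (rule set_eqI)
      show "p \<in> {p. p \<in> ?P \<and> ?K p \<subseteq> ?E h} \<longleftrightarrow> p \<in> {(I, J).
          (I \<subseteq> ?D \<and> J \<subseteq> Peak n \<pi> \<and> I \<inter> J = {}) \<and> I \<union> J \<union> (\<lambda>j. j - 1) ` J \<subseteq> ?E h}" for p
        by (cases p) (simp only: mem_Collect_eq prod.case)
    qed
    also have "\<dots> = {(I, J). I \<subseteq> ?A \<and> J \<subseteq> ?B \<and> I \<inter> J = {}}"
      by (rule descent_peak_pairs_eq[OF assms(1)]) (auto simp: repeats_def)
    finally have "(\<Sum>p | p \<in> ?P \<and> ?K p \<subseteq> ?E h. ?c p * ?w h) =
        (\<Sum>(I, J) | I \<subseteq> ?A \<and> J \<subseteq> ?B \<and> I \<inter> J = {}. (- q) ^ card J * (q - 1) ^ card I) * ?w h"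
      by (simp only: sum_distrib_right case_prod_unfold)
    also have "\<dots> = (if ?B = {} then q ^ card ?A * ?w h else 0)"
      by (subst sum_disjoint_pairs) auto
    finally show "(\<Sum>p | p \<in> ?P \<and> ?K p \<subseteq> ?E h. ?c p * ?w h) = \<dots>" .
  qed
  finally show "mfps_coeff (U q \<pi> \<alpha>) m = mfps_coeff (\<Sum>(I, J)\<in>?P.
      mfps_smult ((- q) ^ card J * (q - 1) ^ card I) (eta q (merge_set2 \<alpha> I J))) m" ..
qed

end
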